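(* Let $X,Y$ be two real Hilbert spaces, $E$ a nonempty subset of $X$ and $G:E\to Y$ a Lipschitz mapping. Then there exists $\widetilde{G}:X\to Y$ with $\widetilde{G}=G$ on $E$ and $\mathrm{Lip}(\widetilde{G})=\mathrm{Lip}(G)$. In fact, if $M=\mathrm{Lip}(G)$, then the function $$\widetilde{G}(x):=\nabla_Y(\mathrm{conv}(g))(x,0),\qquad x\in X,$$ where $$g(x,y)=\inf_{z\in E}\left\{\langle G(z),y\rangle_Y+\tfrac{M}{2}\|x-z\|_X^2\right\}+\tfrac{M}{2}\|x\|_X^2+M\|y\|_Y^2,\qquad (x,y)\in X\times Y,$$ is well defined and is such an extension.
   Context: $\langle\cdot,\cdot\rangle_X,\|\cdot\|_X$ and $\langle\cdot,\cdot\rangle_Y,\|\cdot\|_Y$ denote the inner products and norms of $X$ and $Y$. The product $X\times Y$ is a Hilbert space with $\langle (x,y),(x',y')\rangle=\langle x,x'\rangle_X+\langle y,y'\rangle_Y$. For a Lipschitz mapping $\varphi$, $\mathrm{Lip}(\varphi)=\sup_{x\neq y}\frac{\|\varphi(x)-\varphi(y)\|}{\|x-y\|}$ (over points of its domain; equal to $0$ if the domain is a single point). For a function $g$ on a Hilbert space $Z$, the convex envelope is $\mathrm{conv}(g)(z)=\sup\{h(z): h \text{ convex, proper, lower semicontinuous on } Z,\ h\le g\}$. For a function $F$ on $X\times Y$, $\nabla F$ is its gradient (the Riesz representative of the Fréchet derivative), and $\nabla_Y F$ is the canonical projection $X\times Y\to Y$ composed with $\nabla F$. *)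

theory Defs
  imports "HOL-Analysis.Analysis"
begin

text \<open>
  \<open>Sup\<close> on the reals is meaningful only for nonempty bounded sets, so \<open>Lip S \<phi>\<close> is the
  Lipschitz constant only when \<open>\<phi>\<close> is Lipschitz on \<open>S\<close>; Lipschitz continuity has to be stated
  separately.
\<close>

definition Lip :: "'a::real_normed_vector set \<Rightarrow> ('a \<Rightarrow> 'b::real_normed_vector) \<Rightarrow> real" where
  "Lip S \<phi> =
     (if \<exists>x\<in>S. \<exists>y\<in>S. x \<noteq> y
      then Sup {norm (\<phi> x - \<phi> y) / norm (x - y) |x y. x \<in> S \<and> y \<in> S \<and> x \<noteq> y}
      else 0)"

definition proper_fun :: "('z \<Rightarrow> ereal) \<Rightarrow> bool" where
  "proper_fun h \<longleftrightarrow> (\<forall>z. h z \<noteq> -\<infinity>) \<and> (\<exists>z. h z \<noteq> \<infinity>)"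

text \<open>
  Used only together with \<open>proper_fun\<close>, which excludes sums of infinities of opposite sign.
\<close>

definition convex_fun :: "('z::real_vector \<Rightarrow> ereal) \<Rightarrow> bool" where
  "convex_fun h \<longleftrightarrow>
     (\<forall>x y. \<forall>u\<ge>0. \<forall>v\<ge>0. u + v = 1 \<longrightarrow>
        h (u *\<^sub>R x + v *\<^sub>R y) \<le> ereal u * h x + ereal v * h y)"

definition lsc_fun :: "('z::topological_space \<Rightarrow> ereal) \<Rightarrow> bool" where
  "lsc_fun h \<longleftrightarrow> (\<forall>z. h z \<le> Liminf (at z) h)"

definition conv_env :: "('z::real_normed_vector \<Rightarrow> ereal) \<Rightarrow> 'z \<Rightarrow> ereal" where
  "conv_env g z = (SUP h\<in>{h. convex_fun h \<and> proper_fun h \<and> lsc_fun h \<and> h \<le> g}. h z)"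

text \<open>
  Meaningful only where \<open>F\<close> is differentiable.
\<close>

definition gradient :: "('z::real_inner \<Rightarrow> real) \<Rightarrow> 'z \<Rightarrow> 'z" where
  "gradient F z = (THE D. GDERIV F z :> D)"

definition gradient_Y ::
    "('x::real_inner \<times> 'y::real_inner \<Rightarrow> real) \<Rightarrow> 'x \<times> 'y \<Rightarrow> 'y" where
  "gradient_Y F p = snd (gradient F p)"

text \<open>
  The infimum is taken in the extended reals, so that its finiteness is a claim to be proved and not
  a convention on real infima.
\<close>

definition kirszbraun_g ::
    "'x::real_inner set \<Rightarrow> ('x \<Rightarrow> 'y::real_inner) \<Rightarrow> real \<Rightarrow> 'x \<times> 'y \<Rightarrow> ereal" where
  "kirszbraun_g E G M = (\<lambda>(x, y).
     (INF z\<in>E. ereal (inner (G z) y + M / 2 * (norm (x - z))\<^sup>2))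
       + ereal (M / 2 * (norm x)\<^sup>2 + M * (norm y)\<^sup>2))"

end

theory Submission
  imports Defs
begin

text \<open>
  The function \<open>g\<close> is an infimum of paraboloids \<open>q\<^sub>z(p) = M |p|\<^sup>2 + affine\<close>, and the affine functions
  \<open>l\<^sub>w\<close> with value \<open>M/2 |w|\<^sup>2\<close> and slope \<open>(M w, G w)\<close> at \<open>(w, 0)\<close> lie below every \<open>q\<^sub>z\<close>: this is
  exactly the Lipschitz condition on \<open>G\<close>, after completing squares. Hence \<open>conv g\<close> is finite and touches
  both \<open>l\<^sub>w\<close> and \<open>q\<^sub>w\<close> at \<open>(w, 0)\<close>, which fixes its gradient there. As \<open>g - M |\<cdot>|\<^sup>2\<close> is concave,
  maximality of the envelope makes \<open>conv g - M |\<cdot>|\<^sup>2\<close> concave too, so the convex function \<open>conv g\<close> is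
  squeezed between a tangent plane and a tangent paraboloid of curvature \<open>2 M\<close> at every point. Then
  \<open>\<nabla>(conv g) - M p\<close> is \<open>M\<close>-Lipschitz by cocoercivity, and its \<open>Y\<close>-component on \<open>X \<times> {0}\<close> is the
  extension.
\<close>

section \<open>Riesz representation of bounded linear functionals\<close>

text \<open>Stands in for letting \<open>t\<close> tend to 0 in the first-order arguments below;
  \<open>K\<close> must not depend on \<open>t\<close>.\<close>

lemma eq_0_if_abs_le_mult:
  fixes a K :: real
  assumes "\<And>t. t > 0 \<Longrightarrow> \<bar>a\<bar> \<le> K * t"
  shows "a = 0"
proof (rule ccontr)
  assume "a \<noteq> 0"
  define t where "t = \<bar>a\<bar> / (2 * (\<bar>K\<bar> + 1))"
  have t: "t > 0" using \<open>a \<noteq> 0\<close> by (simp add: t_def)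
  have "K * t \<le> (\<bar>K\<bar> + 1) * t" using t by (intro mult_right_mono) auto
  also have "\<dots> = \<bar>a\<bar> / 2" by (simp add: t_def field_simps)
  also have "\<dots> < \<bar>a\<bar>" using \<open>a \<noteq> 0\<close> by simp
  finally show False using assms[OF t] by simp
qed

text \<open>The representing vector is the minimiser of \<open>J v\<close>, found as the limit of a
  minimising sequence; vanishing of the first variation of \<open>J\<close> there is the
  claim.\<close>

lemma bounded_linear_inner_representation:
  fixes \<phi> :: "'a::{real_inner,complete_space} \<Rightarrow> real"
  assumes "bounded_linear \<phi>"
  shows "\<exists>a. \<forall>x. \<phi> x = inner a x"
proof -
  interpret bounded_linear \<phi> by fact
  obtain K where K: "\<And>x. norm (\<phi> x) \<le> norm x * K" using nonneg_bounded by blast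
  define J where "J v = (norm v)\<^sup>2 - 2 * \<phi> v" for v
  have J_ge: "- K\<^sup>2 \<le> J v" for v
  proof -
    have "0 \<le> (norm v - K)\<^sup>2" by simp
    then show ?thesis using K[of v] by (simp add: J_def power2_eq_square algebra_simps)
  qed
  define m where "m = Inf (range J)"
  have bdd: "bdd_below (range J)" using J_ge by (intro bdd_belowI2) auto
  have m_le: "m \<le> J v" for v unfolding m_def by (intro cInf_lower bdd) auto
  \<comment> \<open>Parallelogram law; the linear part of \<open>J\<close> cancels. Since
    \<open>J\<close> is at least \<open>m\<close> at the midpoint, near-minimisers are close to each
    other.\<close>
  have par: "(norm (a - b))\<^sup>2 + 4 * J ((1/2) *\<^sub>R (a + b)) = 2 * J a + 2 * J b" for a b
    unfolding J_def power2_norm_eq_inner scaleR add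
    by (simp add: inner_simps inner_commute[of b a] field_simps)
  have "\<exists>v. J v < m + 1 / real (Suc n)" for n
    using cInf_lessD[of "range J" "m + 1 / real (Suc n)"] by (auto simp: m_def)
  then obtain v where v: "\<And>n. J (v n) < m + 1 / real (Suc n)" by metis
  have vdist: "(norm (v i - v j))\<^sup>2 \<le> 2 / real (Suc i) + 2 / real (Suc j)" for i j
    using par[of "v i" "v j"] m_le[of "(1/2) *\<^sub>R (v i + v j)"] v[of i] v[of j] by auto
  have "Cauchy v"
  proof (rule metric_CauchyI)
    fix e :: real assume "e > 0"
    then obtain N where N: "1 / real (Suc N) < e\<^sup>2 / 4"
      using nat_approx_posE[of "e\<^sup>2 / 4"] by auto
    show "\<exists>N. \<forall>i\<ge>N. \<forall>j\<ge>N. dist (v i) (v j) < e"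
    proof (intro exI allI impI)
      fix i j assume ij: "N \<le> i" "N \<le> j"
      have "1 / real (Suc i) \<le> 1 / real (Suc N)" "1 / real (Suc j) \<le> 1 / real (Suc N)"
        using ij by (auto simp: field_simps)
      then have "(norm (v i - v j))\<^sup>2 < e\<^sup>2" using vdist[of i j] N by auto
      then show "dist (v i) (v j) < e"
        using \<open>e > 0\<close> by (simp add: dist_norm power2_less_imp_less)
    qed
  qed
  then obtain a where a: "v \<longlonglongrightarrow> a" using Cauchy_convergent convergent_def by blast
  have "(\<lambda>n. J (v n)) \<longlonglongrightarrow> J a"
    unfolding J_def by (intro tendsto_intros a tendsto)
  moreover have "(\<lambda>n. m + 1 / real (Suc n)) \<longlonglongrightarrow> m + 0"
    by (intro tendsto_intros LIMSEQ_Suc lim_1_over_n)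
  ultimately have "J a \<le> m + 0"
    by (rule LIMSEQ_le) (use v less_imp_le in blast)
  then have min: "J a \<le> J w" for w using m_le[of w] by simp
  have "inner a x - \<phi> x = 0" for x
  proof (rule eq_0_if_abs_le_mult)
    fix t :: real assume t: "t > 0"
    \<comment> \<open>This is \<open>J (a + s *\<^sub>R x) - J a\<close>; taking
      \<open>s = t\<close> and \<open>s = -t\<close> bounds the first variation from both
      sides.\<close>
    have *: "0 \<le> s * (2 * (inner a x - \<phi> x) + s * (norm x)\<^sup>2)" for s
      using min[of "a + s *\<^sub>R x"]
      by (simp add: J_def power2_norm_eq_inner add scaleR inner_simps inner_commute[of x a] algebra_simps)
    have "0 \<le> 2 * (inner a x - \<phi> x) + t * (norm x)\<^sup>2"
      using *[of t] t by (simp add: zero_le_mult_iff)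
    moreover have "2 * (inner a x - \<phi> x) + (- t) * (norm x)\<^sup>2 \<le> 0"
      using *[of "-t"] t by (simp add: zero_le_mult_iff mult_le_0_iff)
    ultimately show "\<bar>inner a x - \<phi> x\<bar> \<le> (norm x)\<^sup>2 / 2 * t"
      unfolding abs_le_iff by (simp add: mult.commute)
  qed
  then show ?thesis by (metis right_minus_eq)
qed

section \<open>Functions with tangent planes below and tangent paraboloids above\<close>

text \<open>A derivative-free form of having gradient \<open>A\<close> at \<open>p\<close>, with
  bounds that hold globally and not only near \<open>p\<close>. The factor is \<open>M\<close>, not
  \<open>M / 2\<close>, to match the curvature of the paraboloids in \<open>g\<close>.\<close>

definition quad_tangent :: "real \<Rightarrow> ('z::real_inner \<Rightarrow> real) \<Rightarrow> 'z \<Rightarrow> 'z \<Rightarrow> bool" where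
  "quad_tangent M F p A \<longleftrightarrow>
     (\<forall>q. F p + inner A (q - p) \<le> F q \<and> F q \<le> F p + inner A (q - p) + M * (norm (q - p))\<^sup>2)"

lemma quad_tangent_GDERIV:
  assumes "quad_tangent M F p A"
  shows "GDERIV F p :> A"
  unfolding gderiv_def has_derivative_iff_norm
proof (intro conjI)
  show "bounded_linear (\<lambda>h. inner h A)" by (rule bounded_linear_inner_left)
  show "((\<lambda>y. norm (F y - F p - inner (y - p) A) / norm (y - p)) \<longlongrightarrow> 0) (at p)"
  proof (rule tendsto_sandwich[of "\<lambda>_. 0" _ _ "\<lambda>y. M * norm (y - p)"])
    have "norm (F y - F p - inner (y - p) A) / norm (y - p) \<le> M * norm (y - p)" if "y \<noteq> p" for y
    proof -
      have "norm (F y - F p - inner (y - p) A) \<le> M * (norm (y - p))\<^sup>2"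
        using assms[unfolded quad_tangent_def, rule_format, of y] by (simp add: inner_commute)
      then show ?thesis using that by (simp add: divide_le_eq power2_eq_square mult.assoc)
    qed
    then show "\<forall>\<^sub>F y in at p. norm (F y - F p - inner (y - p) A) / norm (y - p) \<le> M * norm (y - p)"
      by (auto simp: eventually_at_filter)
    show "((\<lambda>y. M * norm (y - p)) \<longlongrightarrow> 0) (at p)"
      by (rule tendsto_eq_intros | simp)+
  qed auto
qed

lemma gradient_eqI:
  assumes "GDERIV F p :> A"
  shows "gradient F p = A"
  unfolding gradient_def
proof (rule the_equality[where a = A])
  show "GDERIV F p :> A" by fact
next
  fix B assume "GDERIV F p :> B"
  then have "(\<lambda>h. inner h B) = (\<lambda>h. inner h A)"
    using assms has_derivative_unique unfolding gderiv_def by blast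
  then have "inner (B - A) (B - A) = 0" by (metis inner_diff_right right_minus_eq)
  then show "B = A" by simp
qed

text \<open>Convexity makes difference quotients at \<open>p\<close> nondecreasing in the step
  \<open>t\<close>; semiconcavity keeps them within \<open>M * t * (norm h)\<^sup>2\<close> of their
  infimum \<open>\<phi> h\<close>. Up to errors of order \<open>t\<close>, convexity makes
  \<open>\<phi>\<close> subadditive and semiconcavity makes it superadditive. Continuity bounds
  \<open>\<phi>\<close>, and the Riesz representation yields \<open>A\<close>.\<close>

lemma quad_tangent_exists:
  fixes F :: "'z::{real_inner,complete_space} \<Rightarrow> real"
  assumes convex: "convex_on UNIV F"
    and semiconcave: "\<And>p q s. 0 \<le> s \<Longrightarrow> s \<le> 1 \<Longrightarrow>
        (1 - s) * F p + s * F q - M * s * (1 - s) * (norm (p - q))\<^sup>2 \<le> F ((1 - s) *\<^sub>R p + s *\<^sub>R q)"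
    and cont: "isCont F p" and M: "M \<ge> 0"
  shows "\<exists>A. quad_tangent M F p A"
proof -
  define d where "d h t = (F (p + t *\<^sub>R h) - F p) / t" for h and t :: real
  have seg: "(1 - s / t) *\<^sub>R p + (s / t) *\<^sub>R (p + t *\<^sub>R h) = p + s *\<^sub>R h" if "0 < t" for s t h
    using that by (simp add: algebra_simps)
  have mono: "d h s \<le> d h t" if "0 < s" "s \<le> t" for h s t
  proof -
    have "F (p + s *\<^sub>R h) \<le> (1 - s / t) * F p + s / t * F (p + t *\<^sub>R h)"
      using convex_onD[OF convex, of "s / t" p "p + t *\<^sub>R h"] that seg[of t s h] by simp
    then show ?thesis using that by (simp add: d_def field_simps)
  qed
  have upper: "d h t - M * t * (norm h)\<^sup>2 \<le> d h s" if "0 < s" "0 < t" for h s t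
  proof (cases "s \<le> t")
    case True
    let ?r = "s / t"
    have "(1 - ?r) * F p + ?r * F (p + t *\<^sub>R h) - M * ?r * (1 - ?r) * (t * norm h)\<^sup>2 \<le> F (p + s *\<^sub>R h)"
      using semiconcave[of ?r p "p + t *\<^sub>R h"] that True seg[of t s h] by simp
    then have "?r * (F (p + t *\<^sub>R h) - F p) - M * ?r * (1 - ?r) * (t * norm h)\<^sup>2 \<le> F (p + s *\<^sub>R h) - F p"
      by (simp add: algebra_simps)
    then have "(?r * (F (p + t *\<^sub>R h) - F p) - M * ?r * (1 - ?r) * (t * norm h)\<^sup>2) / s \<le> d h s"
      using that by (simp add: d_def divide_right_mono)
    moreover have "(?r * (F (p + t *\<^sub>R h) - F p) - M * ?r * (1 - ?r) * (t * norm h)\<^sup>2) / s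
        = d h t - M * t * (norm h)\<^sup>2 + M * s * (norm h)\<^sup>2"
      using that by (simp add: d_def field_simps power2_eq_square)
    moreover have "0 \<le> M * s * (norm h)\<^sup>2" using M that by simp
    ultimately show ?thesis by linarith
  next
    case False
    moreover have "0 \<le> M * t * (norm h)\<^sup>2" using M that by simp
    ultimately show ?thesis using mono[of t s h] that by simp
  qed
  \<comment> \<open>The one-sided directional derivative of \<open>F\<close> at \<open>p\<close>: an
    infimum, by monotonicity of the quotients, and finite by \<open>upper\<close>.\<close>
  define \<phi> where "\<phi> h = (INF t\<in>{0<..}. d h t)" for h
  have \<phi>_le: "\<phi> h \<le> d h t" if "t > 0" for h t
    unfolding \<phi>_def using that upper[of _ 1 h]
    by (intro cINF_lower bdd_belowI2[where m = "d h 1 - M * 1 * (norm h)\<^sup>2"]) auto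
  have \<phi>_ge: "d h t - M * t * (norm h)\<^sup>2 \<le> \<phi> h" if "t > 0" for h t
    unfolding \<phi>_def using that upper by (intro cINF_greatest) auto
  have approx: "\<bar>\<phi> h - d h t\<bar> \<le> M * (norm h)\<^sup>2 * t" if "t > 0" for h t
    using \<phi>_le[OF that, of h] \<phi>_ge[OF that, of h] by (simp add: abs_le_iff algebra_simps)
  have add: "\<phi> (u + v) = \<phi> u + \<phi> v" for u v
  proof -
    have "\<phi> (u + v) - \<phi> u - \<phi> v = 0"
    proof (rule eq_0_if_abs_le_mult)
      fix t :: real assume t: "t > 0"
      \<comment> \<open>The steps are doubled so that the midpoint of \<open>?a\<close> and
        \<open>?b\<close> is \<open>p + t *\<^sub>R (u + v)\<close>.\<close>
      let ?a = "p + (2 * t) *\<^sub>R u" and ?b = "p + (2 * t) *\<^sub>R v"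
      have mid: "(1 - 1 / 2) *\<^sub>R ?a + (1 / 2) *\<^sub>R ?b = p + t *\<^sub>R (u + v)"
        by (simp add: algebra_simps flip: scaleR_add_left)
      have 1: "F (p + t *\<^sub>R (u + v)) \<le> F ?a / 2 + F ?b / 2"
        using convex_onD[OF convex, of "1/2" ?a ?b] mid by simp
      have "norm (?a - ?b) = 2 * t * norm (u - v)"
        using t norm_scaleR[of "2 * t" "u - v"] by (simp add: algebra_simps)
      then have 2: "F ?a / 2 + F ?b / 2 - M * (t * norm (u - v))\<^sup>2 \<le> F (p + t *\<^sub>R (u + v))"
        using semiconcave[of "1/2" ?a ?b] mid by (simp add: power_mult_distrib)
      have "d (u + v) t - d u (2 * t) - d v (2 * t)
          = (F (p + t *\<^sub>R (u + v)) - F ?a / 2 - F ?b / 2) / t"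
        using t by (simp add: d_def field_simps)
      moreover have "\<dots> \<le> 0" using 1 t by (simp add: divide_le_0_iff)
      moreover have "- (M * (norm (u - v))\<^sup>2 * t) \<le> (F (p + t *\<^sub>R (u + v)) - F ?a / 2 - F ?b / 2) / t"
        using 2 t by (simp add: field_simps power2_eq_square)
      ultimately have "\<bar>d (u + v) t - d u (2 * t) - d v (2 * t)\<bar> \<le> M * (norm (u - v))\<^sup>2 * t"
        using t M by (simp add: abs_le_iff)
      then show "\<bar>\<phi> (u + v) - \<phi> u - \<phi> v\<bar> \<le>
          (M * (norm (u - v))\<^sup>2 + M * (norm (u + v))\<^sup>2 + 2 * M * (norm u)\<^sup>2 + 2 * M * (norm v)\<^sup>2) * t"
        using approx[of t "u + v"] approx[of "2 * t" u] approx[of "2 * t" v] t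
        by (simp add: algebra_simps)
    qed
    then show ?thesis by simp
  qed
  have scale_pos: "\<phi> (c *\<^sub>R u) = c * \<phi> u" if c: "c > 0" for c u
  proof -
    have "\<phi> (c *\<^sub>R u) - c * \<phi> u = 0"
    proof (rule eq_0_if_abs_le_mult)
      fix t :: real assume t: "t > 0"
      have eq: "d (c *\<^sub>R u) t = c * d u (c * t)" using c by (simp add: d_def mult.commute)
      have "\<bar>c * \<phi> u - c * d u (c * t)\<bar> = c * \<bar>\<phi> u - d u (c * t)\<bar>"
        using c by (simp add: abs_mult flip: right_diff_distrib)
      also have "\<dots> \<le> c * (M * (norm u)\<^sup>2 * (c * t))"
        using c t by (intro mult_left_mono approx) auto
      finally show "\<bar>\<phi> (c *\<^sub>R u) - c * \<phi> u\<bar> \<le>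
          (M * (norm (c *\<^sub>R u))\<^sup>2 + c * (M * (norm u)\<^sup>2 * c)) * t"
        using approx[of t "c *\<^sub>R u"] t eq by (simp add: algebra_simps)
    qed
    then show ?thesis by simp
  qed
  have zero: "\<phi> 0 = 0" using add[of 0 0] by simp
  have neg: "\<phi> (- u) = - \<phi> u" for u using add[of u "- u"] zero by simp
  have scale: "\<phi> (c *\<^sub>R u) = c *\<^sub>R \<phi> u" for c u
  proof -
    consider "c > 0" | "c = 0" | "- c > 0" by linarith
    then show ?thesis
      by cases (use scale_pos[of c u] scale_pos[of "- c" u] neg[of "c *\<^sub>R u"] zero in auto)
  qed
  \<comment> \<open>Continuity at \<open>p\<close> bounds \<open>\<phi>\<close> above on a ball,
    through the quotient with step 1; homogeneity turns this into a linear bound.\<close>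
  obtain \<delta> where \<delta>: "\<delta> > 0" "\<And>q. dist q p < \<delta> \<Longrightarrow> dist (F q) (F p) < 1"
    using cont[unfolded continuous_at_eps_delta, rule_format, of 1] by auto
  have le1: "\<phi> h \<le> 1" if "norm h < \<delta>" for h
    using \<phi>_le[of 1 h] \<delta>(2)[of "p + h"] that by (simp add: d_def dist_norm)
  have bound: "\<bar>\<phi> h\<bar> \<le> norm h * (2 / \<delta>)" for h
  proof (cases "h = 0")
    case False
    define c where "c = \<delta> / (2 * norm h)"
    have c: "c > 0" "norm (c *\<^sub>R h) < \<delta>" using False \<delta>(1) by (auto simp: c_def)
    have "c * \<bar>\<phi> h\<bar> \<le> 1"
      using le1[of "c *\<^sub>R h"] le1[of "- (c *\<^sub>R h)"] c scale[of c h] neg[of "c *\<^sub>R h"]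
      by (auto simp: abs_if)
    then show ?thesis using False \<delta>(1) by (simp add: c_def field_simps)
  qed (simp add: zero)
  have "bounded_linear \<phi>"
    by (rule bounded_linear_intro[where K = "2 / \<delta>"]) (use add scale bound in simp_all)
  then obtain A where A: "\<And>h. \<phi> h = inner A h"
    using bounded_linear_inner_representation by blast
  have "quad_tangent M F p A"
    unfolding quad_tangent_def
  proof
    fix q
    show "F p + inner A (q - p) \<le> F q \<and> F q \<le> F p + inner A (q - p) + M * (norm (q - p))\<^sup>2"
      using \<phi>_le[of 1 "q - p"] \<phi>_ge[of 1 "q - p"] by (simp add: d_def A)
  qed
  then show ?thesis ..
qed

text \<open>
  The slope \<open>A - M p\<close> is the gradient of \<open>F - M/2 |\<cdot>|\<^sup>2\<close>. Comparing the two paraboloids at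
  \<open>q - s (B - A)\<close> gives cocoercivity of the gradient.
\<close>

lemma quad_tangent_lipschitz:
  assumes A: "quad_tangent M F p A" and B: "quad_tangent M F q B" and M: "M \<ge> 0"
  shows "norm ((B - M *\<^sub>R q) - (A - M *\<^sub>R p)) \<le> M * norm (q - p)"
proof -
  define D where "D = B - A"
  have co: "2 * s * (norm D)\<^sup>2 - 2 * M * s\<^sup>2 * (norm D)\<^sup>2 \<le> inner D (q - p)" for s
  proof -
    have 1: "F p + inner A (q - s *\<^sub>R D - p) \<le> F q + inner B (- (s *\<^sub>R D)) + M * (norm (s *\<^sub>R D))\<^sup>2"
      using A[unfolded quad_tangent_def, rule_format, of "q - s *\<^sub>R D"]
        B[unfolded quad_tangent_def, rule_format, of "q - s *\<^sub>R D"] by simp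
    \<comment> \<open>The mirror comparison with \<open>p\<close> and \<open>q\<close> exchanged; in
      the sum of both, \<open>F p\<close> and \<open>F q\<close> cancel.\<close>
    have 2: "F q + inner B (p + s *\<^sub>R D - q) \<le> F p + inner A (s *\<^sub>R D) + M * (norm (s *\<^sub>R D))\<^sup>2"
      using A[unfolded quad_tangent_def, rule_format, of "p + s *\<^sub>R D"]
        B[unfolded quad_tangent_def, rule_format, of "p + s *\<^sub>R D"] by simp
    have "inner B D = inner A D + (norm D)\<^sup>2"
      by (simp add: D_def power2_norm_eq_inner inner_simps)
    moreover have "inner B (q - p) = inner A (q - p) + inner D (q - p)"
      by (simp add: D_def inner_diff_left)
    moreover have "inner A (q - s *\<^sub>R D - p) = inner A (q - p) - s * inner A D"
      "inner B (p + s *\<^sub>R D - q) = s * inner B D - inner B (q - p)"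
      by (simp_all add: inner_diff_right inner_add_right)
    ultimately show ?thesis using 1 2 by (simp add: power_mult_distrib algebra_simps)
  qed
  \<comment> \<open>For positive \<open>M\<close>, \<open>s = 1 / (2 * M)\<close> maximises the left
    side of \<open>co\<close>. For \<open>M = 0\<close> that side grows linearly in
    \<open>s\<close>, which forces \<open>D = 0\<close>.\<close>
  have key: "(norm D)\<^sup>2 \<le> 2 * M * inner D (q - p)"
  proof (cases "M = 0")
    case True
    have "(norm D)\<^sup>2 = 0"
    proof (rule ccontr)
      assume "(norm D)\<^sup>2 \<noteq> 0"
      moreover define s where "s = (inner D (q - p) + 1) / (2 * (norm D)\<^sup>2)"
      ultimately have "2 * s * (norm D)\<^sup>2 = inner D (q - p) + 1" by simp
      then show False using co[of s] True by simp
    qed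
    then show ?thesis using True by simp
  next
    case False
    then have "2 * (1 / (2 * M)) * (norm D)\<^sup>2 - 2 * M * (1 / (2 * M))\<^sup>2 * (norm D)\<^sup>2 = (norm D)\<^sup>2 / (2 * M)"
      by (simp add: field_simps power2_eq_square)
    then show ?thesis using False M co[of "1 / (2 * M)"] by (simp add: divide_le_eq mult.commute)
  qed
  have "(B - M *\<^sub>R q) - (A - M *\<^sub>R p) = D - M *\<^sub>R (q - p)" by (simp add: D_def algebra_simps)
  moreover have "(norm (D - M *\<^sub>R (q - p)))\<^sup>2 = (norm D)\<^sup>2 - 2 * M * inner D (q - p) + (M * norm (q - p))\<^sup>2"
    unfolding power_mult_distrib power2_norm_eq_inner inner_diff_left inner_diff_right
      inner_scaleR_left inner_scaleR_right
    by (simp add: inner_commute algebra_simps power2_eq_square)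
  ultimately have "(norm ((B - M *\<^sub>R q) - (A - M *\<^sub>R p)))\<^sup>2
      = (norm D)\<^sup>2 - 2 * M * inner D (q - p) + (M * norm (q - p))\<^sup>2"
    by (simp only:)
  then have "(norm ((B - M *\<^sub>R q) - (A - M *\<^sub>R p)))\<^sup>2 \<le> (M * norm (q - p))\<^sup>2"
    using key by linarith
  then show ?thesis by (rule power2_le_imp_le) (use M in simp)
qed

text \<open>Identifies the slope from any affine minorant touching \<open>F\<close> at
  \<open>p\<close>: moving by \<open>t *\<^sub>R (L - A)\<close>, the minorant gains an amount of
  order \<open>t\<close> over the tangent plane, while the paraboloid allows only order
  \<open>t\<^sup>2\<close>.\<close>

lemma quad_tangent_le_eq:
  assumes "quad_tangent M F p A" and le: "\<And>q. F p + inner L (q - p) \<le> F q"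
  shows "A = L"
proof -
  let ?D = "L - A"
  have "(norm ?D)\<^sup>2 = 0"
  proof (rule eq_0_if_abs_le_mult)
    fix t :: real assume t: "t > 0"
    have "inner ?D (t *\<^sub>R ?D) \<le> M * (norm (t *\<^sub>R ?D))\<^sup>2"
      using assms(1)[unfolded quad_tangent_def, rule_format, of "p + t *\<^sub>R ?D"] le[of "p + t *\<^sub>R ?D"]
      by (simp add: inner_diff_left right_diff_distrib)
    then have "t * (norm ?D)\<^sup>2 \<le> t * (M * (norm ?D)\<^sup>2 * t)"
      by (simp add: power_mult_distrib power2_norm_eq_inner power2_eq_square[of t] mult_ac)
    then show "\<bar>(norm ?D)\<^sup>2\<bar> \<le> M * (norm ?D)\<^sup>2 * t" using t by simp
  qed
  then show ?thesis by simp
qed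

section \<open>The convex envelope\<close>

lemma conv_env_le: "conv_env g z \<le> g z"
  unfolding conv_env_def by (rule SUP_least) (auto simp: le_fun_def)

lemma convex_fun_conv_env: "convex_fun (conv_env g)"
  unfolding convex_fun_def
proof (intro allI impI)
  fix x y and u v :: real assume uv: "0 \<le> u" "0 \<le> v" "u + v = 1"
  show "conv_env g (u *\<^sub>R x + v *\<^sub>R y) \<le> ereal u * conv_env g x + ereal v * conv_env g y"
    unfolding conv_env_def[of g "u *\<^sub>R x + v *\<^sub>R y"]
  proof (rule SUP_least)
    fix h assume h: "h \<in> {h. convex_fun h \<and> proper_fun h \<and> lsc_fun h \<and> h \<le> g}"
    have le: "h z \<le> conv_env g z" for z
      unfolding conv_env_def using h by (rule SUP_upper)
    have "h (u *\<^sub>R x + v *\<^sub>R y) \<le> ereal u * h x + ereal v * h y"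
      using h uv unfolding convex_fun_def by blast
    also have "\<dots> \<le> ereal u * conv_env g x + ereal v * conv_env g y"
      using uv by (intro add_mono ereal_mult_left_mono le) auto
    finally show "h (u *\<^sub>R x + v *\<^sub>R y) \<le> ereal u * conv_env g x + ereal v * conv_env g y" .
  qed
qed

lemma conv_env_greatest:
  fixes f :: "'z::real_normed_vector \<Rightarrow> real"
  assumes convex: "convex_on UNIV f" and cont: "continuous_on UNIV f" and le: "\<And>p. ereal (f p) \<le> g p"
  shows "ereal (f z) \<le> conv_env g z"
  unfolding conv_env_def
proof (rule SUP_upper2[where i = "\<lambda>p. ereal (f p)"])
  have "convex_fun (\<lambda>p. ereal (f p))"
    unfolding convex_fun_def using convex by (simp add: convex_on_def)
  moreover have "lsc_fun (\<lambda>p. ereal (f p))"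
    unfolding lsc_fun_def
  proof
    fix p
    have "((\<lambda>p. ereal (f p)) \<longlongrightarrow> ereal (f p)) (at p)"
      using cont by (simp add: continuous_on_def tendsto_ereal)
    then show "ereal (f p) \<le> Liminf (at p) (\<lambda>p. ereal (f p))"
      \<comment> \<open>In a zero-dimensional space \<open>at p\<close> is trivial, and
        \<open>Liminf\<close> then takes the top value.\<close>
      by (cases "at p = bot") (simp_all only: lim_imp_Liminf[of "at p"] Liminf_bot order_refl top_greatest not_False_eq_True)
  qed
  ultimately show "(\<lambda>p. ereal (f p)) \<in> {h. convex_fun h \<and> proper_fun h \<and> lsc_fun h \<and> h \<le> g}"
    using le by (simp add: proper_fun_def le_fun_def)
qed simp

text \<open>In infinite dimension convexity alone does not give continuity. The continuous bounds
  \<open>l\<close> and \<open>u\<close> make \<open>F\<close> bounded near each point, and a convex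
  function bounded on an open ball is continuous there.\<close>

lemma convex_on_sandwich_continuous:
  fixes F :: "'z::real_normed_vector \<Rightarrow> real"
  assumes convex: "convex_on UNIV F" and l: "continuous_on UNIV l" and u: "continuous_on UNIV u"
    and lF: "\<And>p. l p \<le> F p" and Fu: "\<And>p. F p \<le> u p"
  shows "continuous_on UNIV F"
proof (rule continuous_at_imp_continuous_on, rule ballI)
  fix p
  obtain d1 where d1: "d1 > 0" "\<And>q. dist q p < d1 \<Longrightarrow> dist (l q) (l p) < 1"
    using l[unfolded continuous_on_iff, rule_format, of p 1] by auto
  obtain d2 where d2: "d2 > 0" "\<And>q. dist q p < d2 \<Longrightarrow> dist (u q) (u p) < 1"
    using u[unfolded continuous_on_iff, rule_format, of p 1] by auto
  let ?B = "ball p (min d1 d2)"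
  have "\<bar>F q\<bar> \<le> \<bar>l p\<bar> + \<bar>u p\<bar> + 1" if "q \<in> ?B" for q
    using d1(2)[of q] d2(2)[of q] lF[of q] Fu[of q] that by (auto simp: dist_commute dist_real_def)
  then have "continuous_on ?B F"
    by (intro convex_on_bounded_continuous[where b = "\<bar>l p\<bar> + \<bar>u p\<bar> + 1"] convex_on_subset[OF convex]) auto
  moreover have "p \<in> ?B" using d1 d2 by simp
  ultimately show "isCont F p" using continuous_on_eq_continuous_at open_ball by blast
qed

text \<open>The minorant \<open>l\<close> competes in the supremum and \<open>g\<close> bounds it
  from above, so the envelope is finite and can be treated as a real function.\<close>

lemma conv_env_real:
  fixes g :: "'z::real_normed_vector \<Rightarrow> real"
  assumes l: "convex_on UNIV l" "continuous_on UNIV l" and lg: "\<And>p. l p \<le> g p"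
    and u: "continuous_on UNIV u" and gu: "\<And>p. g p \<le> u p"
  obtains F where "\<And>p. conv_env (\<lambda>p. ereal (g p)) p = ereal (F p)"
    and "convex_on UNIV F" and "continuous_on UNIV F" and "\<And>p. F p \<le> g p"
proof -
  let ?g = "\<lambda>p. ereal (g p)"
  define F where "F p = real_of_ereal (conv_env ?g p)" for p
  have l_le: "ereal (l p) \<le> conv_env ?g p" for p by (rule conv_env_greatest[OF l]) (simp add: lg)
  have F: "conv_env ?g p = ereal (F p)" for p
    using l_le[of p] conv_env_le[of ?g p] by (cases "conv_env ?g p") (auto simp: F_def)
  have "convex_on UNIV F"
    using convex_fun_conv_env[of ?g] unfolding convex_fun_def F convex_on_def by simp
  moreover have Fg: "F p \<le> g p" for p using conv_env_le[of ?g p] F by simp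
  moreover have "continuous_on UNIV F"
    using \<open>convex_on UNIV F\<close> l(2) u
    by (rule convex_on_sandwich_continuous) (use l_le F Fg gu in \<open>auto intro: order_trans[OF Fg gu]\<close>)
  ultimately show thesis using that F by blast
qed

text \<open>
  The left-hand side, as a function of the point \<open>(1 - s) p + s q\<close> with \<open>p - q\<close> fixed, is a
  convex minorant of \<open>g\<close>, so it lies below the largest one.
\<close>

lemma conv_env_semiconcave:
  fixes g F :: "'z::real_normed_vector \<Rightarrow> real"
  assumes F: "\<And>p. conv_env (\<lambda>p. ereal (g p)) p = ereal (F p)"
    and convex: "convex_on UNIV F" and cont: "continuous_on UNIV F" and Fg: "\<And>p. F p \<le> g p"
    and g: "\<And>p q. (1 - s) * g p + s * g q - M * s * (1 - s) * (norm (p - q))\<^sup>2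
               \<le> g ((1 - s) *\<^sub>R p + s *\<^sub>R q)"
    and s: "0 \<le> s" "s \<le> 1"
  shows "(1 - s) * F p + s * F q - M * s * (1 - s) * (norm (p - q))\<^sup>2 \<le> F ((1 - s) *\<^sub>R p + s *\<^sub>R q)"
proof -
  \<comment> \<open>The shifts are chosen so that \<open>r\<close> is the combination of
    \<open>r + a\<close> and \<open>r + b\<close> with weights \<open>1 - s\<close> and
    \<open>s\<close>, and so that these points are \<open>p\<close> and \<open>q\<close> when
    \<open>r\<close> is the combination of \<open>p\<close> and \<open>q\<close>.\<close>
  define a where "a = s *\<^sub>R (p - q)"
  define b where "b = (s - 1) *\<^sub>R (p - q)"
  have ab: "a - b = p - q" by (simp add: a_def b_def algebra_simps)
  have ab0: "(1 - s) *\<^sub>R (r + a) + s *\<^sub>R (r + b) = r" for r by (simp add: a_def b_def algebra_simps)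
  define k where "k r = (1 - s) * F (r + a) + s * F (r + b) - M * s * (1 - s) * (norm (p - q))\<^sup>2" for r
  have shift: "convex_on UNIV (\<lambda>r. F (r + c))" for c
    unfolding convex_on_def
  proof (intro conjI ballI allI impI)
    fix x y and u v :: real assume "0 \<le> u" "0 \<le> v" and uv: "u + v = 1"
    have "u *\<^sub>R x + v *\<^sub>R y + c = u *\<^sub>R (x + c) + v *\<^sub>R (y + c)"
      using uv by (simp add: algebra_simps flip: scaleR_add_left)
    then show "F (u *\<^sub>R x + v *\<^sub>R y + c) \<le> u * F (x + c) + v * F (y + c)"
      using convex \<open>0 \<le> u\<close> \<open>0 \<le> v\<close> uv unfolding convex_on_def by simp
  qed simp
  have "convex_on UNIV (\<lambda>r. (1 - s) * F (r + a) + s * F (r + b) + - (M * s * (1 - s) * (norm (p - q))\<^sup>2))"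
    using s by (intro convex_on_add convex_on_cmul shift) (auto simp: convex_on_const)
  then have "convex_on UNIV k" by (simp add: k_def[abs_def])
  moreover have "continuous_on UNIV k"
    unfolding k_def by (intro continuous_intros continuous_on_compose2[OF cont]) auto
  moreover have "k r \<le> g r" for r
  proof -
    have "k r \<le> (1 - s) * g (r + a) + s * g (r + b) - M * s * (1 - s) * (norm (p - q))\<^sup>2"
      unfolding k_def using s by (intro diff_right_mono add_mono mult_left_mono Fg) auto
    also have "\<dots> \<le> g r" using g[of "r + a" "r + b"] by (simp add: ab ab0)
    finally show ?thesis .
  qed
  ultimately have "ereal (k r) \<le> ereal (F r)" for r
    unfolding F[symmetric] by (intro conv_env_greatest) auto
  moreover have "(1 - s) *\<^sub>R p + s *\<^sub>R q + a = p" "(1 - s) *\<^sub>R p + s *\<^sub>R q + b = q"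
    by (simp_all add: a_def b_def algebra_simps)
  ultimately show ?thesis using k_def[of "(1 - s) *\<^sub>R p + s *\<^sub>R q"] by (metis ereal_less_eq(3))
qed

section \<open>The Lipschitz constant\<close>

text \<open>The constant \<open>C\<close> serves to bound the set of quotients, so that the real
  \<open>Sup\<close> in \<open>Lip\<close> is a true supremum.\<close>

lemma norm_diff_le_Lip:
  assumes "lipschitz_on C S f" "x \<in> S" "y \<in> S"
  shows "norm (f x - f y) \<le> Lip S f * norm (x - y)"
proof (cases "x = y")
  case False
  let ?Q = "{norm (f x - f y) / norm (x - y) |x y. x \<in> S \<and> y \<in> S \<and> x \<noteq> y}"
  have "bdd_above ?Q"
    using lipschitz_onD[OF assms(1)] by (intro bdd_aboveI[of _ C]) (auto simp: divide_le_eq dist_norm)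
  then have "norm (f x - f y) / norm (x - y) \<le> Sup ?Q"
    using assms False by (intro cSup_upper) auto
  also have "Sup ?Q = Lip S f" using assms False by (auto simp: Lip_def)
  finally show ?thesis using False by (simp add: divide_le_eq)
qed simp

lemma Lip_le:
  assumes "0 \<le> M" "\<And>x y. x \<in> S \<Longrightarrow> y \<in> S \<Longrightarrow> norm (f x - f y) \<le> M * norm (x - y)"
  shows "Lip S f \<le> M"
proof (cases "\<exists>x\<in>S. \<exists>y\<in>S. x \<noteq> y")
  case True
  then have "Sup {norm (f x - f y) / norm (x - y) |x y. x \<in> S \<and> y \<in> S \<and> x \<noteq> y} \<le> M"
    using assms by (intro cSup_least) (auto simp: divide_le_eq)
  then show ?thesis using True by (simp add: Lip_def)
next
  case False
  then show ?thesis using assms(1) unfolding Lip_def by (subst if_not_P) auto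
qed

lemma Lip_nonneg:
  assumes "lipschitz_on C S f"
  shows "0 \<le> Lip S f"
proof (cases "\<exists>x\<in>S. \<exists>y\<in>S. x \<noteq> y")
  case True
  then obtain x y where "x \<in> S" "y \<in> S" "x \<noteq> y" by blast
  then have "0 \<le> Lip S f * norm (x - y)" using norm_diff_le_Lip[OF assms] norm_ge_zero order_trans by blast
  then show ?thesis using \<open>x \<noteq> y\<close> by (simp add: zero_le_mult_iff)
next
  case False
  then show ?thesis unfolding Lip_def by (subst if_not_P) auto
qed

section \<open>The function \<open>g\<close> and its envelope\<close>

definition paraboloid :: "('x::real_inner \<Rightarrow> 'y::real_inner) \<Rightarrow> real \<Rightarrow> 'x \<Rightarrow> 'x \<times> 'y \<Rightarrow> real" where
  "paraboloid G M z p = M * (norm p)\<^sup>2 + inner (- M *\<^sub>R z, G z) p + M / 2 * (norm z)\<^sup>2"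

text \<open>The tangent plane at \<open>(w, 0)\<close> to the paraboloid of the same index
  \<open>w\<close>.\<close>

definition tangent_plane :: "('x::real_inner \<Rightarrow> 'y::real_inner) \<Rightarrow> real \<Rightarrow> 'x \<Rightarrow> 'x \<times> 'y \<Rightarrow> real" where
  "tangent_plane G M w p = M / 2 * (norm w)\<^sup>2 + inner (M *\<^sub>R w, G w) (p - (w, 0))"

text \<open>Expanding the square gives a second \<open>M / 2 * (norm (fst p))\<^sup>2\<close>, so
  the quadratic part becomes \<open>M * (norm p)\<^sup>2\<close> for every \<open>z\<close> and only
  an affine part depends on \<open>z\<close>.\<close>

lemma kirszbraun_g_eq_paraboloid:
  "inner (G z) (snd p) + M / 2 * (norm (fst p - z))\<^sup>2 + (M / 2 * (norm (fst p))\<^sup>2 + M * (norm (snd p))\<^sup>2)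
     = paraboloid G M z p"
proof -
  obtain x y where p: "p = (x, y)" by fastforce
  have 1: "(norm (x - z))\<^sup>2 = (norm x)\<^sup>2 - 2 * inner z x + (norm z)\<^sup>2"
    unfolding power2_norm_eq_inner
    by (simp add: inner_diff_left inner_diff_right inner_commute[of x z])
  have 2: "(norm p)\<^sup>2 = (norm x)\<^sup>2 + (norm y)\<^sup>2" by (simp add: p power2_norm_eq_inner)
  show ?thesis unfolding paraboloid_def 2 unfolding p fst_conv snd_conv 1
    by (simp add: field_simps)
qed

text \<open>The difference is \<open>M\<close> times two squares, centred at
  \<open>norm y = norm (z - w) / 2\<close> and at the midpoint of \<open>z\<close> and
  \<open>w\<close>, plus a remainder that is nonnegative by Cauchy-Schwarz and the Lipschitz
  bound.\<close>

lemma tangent_plane_le_paraboloid: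
  assumes M: "0 \<le> M" and G: "norm (G z - G w) \<le> M * norm (z - w)"
  shows "tangent_plane G M w p \<le> paraboloid G M z p"
proof -
  obtain x y where p: "p = (x, y)" by fastforce
  have "- inner (G z - G w) y \<le> norm (G z - G w) * norm y"
    using norm_cauchy_schwarz[of "G w - G z" y] by (simp add: inner_diff_left norm_minus_commute)
  also have "\<dots> \<le> M * norm (z - w) * norm y" by (rule mult_right_mono[OF G]) simp
  finally have 1: "0 \<le> M * norm (z - w) * norm y + inner (G z - G w) y" by simp
  have 2: "(norm (x - (1/2) *\<^sub>R (z + w)))\<^sup>2
      = inner x x - inner x z - inner x w + (inner z z + 2 * inner z w + inner w w) / 4"
    unfolding power2_norm_eq_inner
    by (simp add: inner_diff_left inner_diff_right inner_add_left inner_add_right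
        inner_commute[of z x] inner_commute[of w x] inner_commute[of w z] field_simps)
  have 3: "(norm (z - w))\<^sup>2 = inner z z - 2 * inner z w + inner w w"
    unfolding power2_norm_eq_inner
    by (simp add: inner_diff_left inner_diff_right inner_commute[of w z])
  have 4: "(norm p)\<^sup>2 = inner x x + (norm y)\<^sup>2" by (simp add: p power2_norm_eq_inner)
  have 5: "inner (- M *\<^sub>R z, G z) p = - (M * inner x z) + inner (G z) y"
    "inner (M *\<^sub>R w, G w) (p - (w, 0)) = M * inner x w - M * inner w w + inner (G w) y"
    by (simp_all add: p inner_diff_right inner_commute[of z x] inner_commute[of w x] right_diff_distrib)
  have "paraboloid G M z p - tangent_plane G M w p
      = (M * norm (z - w) * norm y + inner (G z - G w) y)
        + M * ((norm y - norm (z - w) / 2)\<^sup>2 + (norm (x - (1/2) *\<^sub>R (z + w)))\<^sup>2)"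
    unfolding paraboloid_def tangent_plane_def power2_diff power_divide 2 3 4 5
      power2_norm_eq_inner[of z] power2_norm_eq_inner[of w] inner_diff_left
    by (simp add: field_simps)
  then show ?thesis using 1 M
    by (smt (verit) mult_nonneg_nonneg zero_le_power2)
qed

text \<open>Semiconcavity with equality: affine parts cancel and \<open>M * (norm p)\<^sup>2\<close>
  gives exactly the correction term. As an inequality it passes to the infimum
  \<open>g\<close>.\<close>

lemma paraboloid_affine_combination:
  "(1 - s) * paraboloid G M z p + s * paraboloid G M z q - M * s * (1 - s) * (norm (p - q))\<^sup>2
     = paraboloid G M z ((1 - s) *\<^sub>R p + s *\<^sub>R q)"
  unfolding paraboloid_def power2_norm_eq_inner inner_add_left inner_add_right inner_diff_left
    inner_diff_right inner_scaleR_left inner_scaleR_right inner_commute[of q p]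
  by (simp add: field_simps)

text \<open>The tangent plane of any point of \<open>E\<close> bounds the infimum from below, so it
  is finite. The last two properties describe \<open>g p\<close> as a greatest lower bound, the form
  used afterwards.\<close>

lemma kirszbraun_g_real:
  fixes G :: "'x::real_inner \<Rightarrow> 'y::real_inner"
  assumes "E \<noteq> {}" and M: "0 \<le> M"
    and lip: "\<And>z w. z \<in> E \<Longrightarrow> w \<in> E \<Longrightarrow> norm (G z - G w) \<le> M * norm (z - w)"
  obtains g where "kirszbraun_g E G M = (\<lambda>p. ereal (g p))"
    and "\<And>z p. z \<in> E \<Longrightarrow> g p \<le> paraboloid G M z p"
    and "\<And>a p. (\<And>z. z \<in> E \<Longrightarrow> a \<le> paraboloid G M z p) \<Longrightarrow> a \<le> g p"
proof -
  define g where "g p = (INF z\<in>E. paraboloid G M z p)" for p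
  have bdd: "bdd_below ((\<lambda>z. paraboloid G M z p) ` E)" for p
  proof -
    obtain w where "w \<in> E" using \<open>E \<noteq> {}\<close> by blast
    then show ?thesis
      using tangent_plane_le_paraboloid[where G = G and w = w, OF M lip]
      by (intro bdd_belowI2[where m = "tangent_plane G M w p"]) auto
  qed
  have le: "g p \<le> paraboloid G M z p" if "z \<in> E" for z p
    unfolding g_def using bdd that by (rule cINF_lower)
  have ge: "a \<le> g p" if "\<And>z. z \<in> E \<Longrightarrow> a \<le> paraboloid G M z p" for a p
    unfolding g_def using \<open>E \<noteq> {}\<close> that by (rule cINF_greatest)
  have "kirszbraun_g E G M p = ereal (g p)" for p
  proof -
    obtain x y where p: "p = (x, y)" by fastforce
    let ?c = "M / 2 * (norm x)\<^sup>2 + M * (norm y)\<^sup>2"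
    have q: "inner (G z) y + M / 2 * (norm (x - z))\<^sup>2 = paraboloid G M z p - ?c" for z
      using kirszbraun_g_eq_paraboloid[of G z p M] by (simp add: p)
    have "(INF z\<in>E. ereal (paraboloid G M z p - ?c)) = ereal (g p - ?c)"
    proof (rule INF_eqI)
      show "ereal (g p - ?c) \<le> ereal (paraboloid G M z p - ?c)" if "z \<in> E" for z
        using le[OF that] by simp
      fix b assume b: "\<And>z. z \<in> E \<Longrightarrow> b \<le> ereal (paraboloid G M z p - ?c)"
      show "b \<le> ereal (g p - ?c)"
      proof (cases b)
        case (real r)
        have "r + ?c \<le> g p" by (rule ge) (use b real in fastforce)
        then show ?thesis using real by simp
      \<comment> \<open>An infinite upper value of \<open>b\<close> is excluded because
        \<open>E\<close> is nonempty.\<close>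
      qed (use b \<open>E \<noteq> {}\<close> in auto)
    qed
    then show ?thesis unfolding kirszbraun_g_def p prod.case q[unfolded p] by simp
  qed
  then show thesis using that le ge by blast
qed

lemma convex_on_tangent_plane: "convex_on UNIV (tangent_plane G M w)"
  unfolding convex_on_def
proof (intro conjI ballI allI impI)
  fix p q and u v :: real assume "0 \<le> u" "0 \<le> v" and uv: "u + v = 1"
  have v: "v = 1 - u" using uv by simp
  show "tangent_plane G M w (u *\<^sub>R p + v *\<^sub>R q) \<le> u * tangent_plane G M w p + v * tangent_plane G M w q"
    unfolding tangent_plane_def v
    by (simp add: inner_diff_right inner_add_right field_simps)
qed simp

lemma continuous_on_tangent_plane: "continuous_on S (tangent_plane G M w)"
  unfolding tangent_plane_def by (intro continuous_intros)

lemma continuous_on_paraboloid: "continuous_on S (paraboloid G M z)"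
  unfolding paraboloid_def by (intro continuous_intros)

text \<open>Semiconcavity passes from the paraboloids to \<open>g\<close> and from \<open>g\<close>
  to \<open>F\<close>, which yields a slope at every point; over \<open>E\<close> the tangent plane
  is a touching minorant of \<open>F\<close> and fixes that slope.\<close>

lemma kirszbraun_conv_env:
  fixes E :: "'x::{real_inner, complete_space} set"
    and G :: "'x \<Rightarrow> 'y::{real_inner, complete_space}"
  assumes "E \<noteq> {}" and M: "0 \<le> M"
    and lip: "\<And>z w. z \<in> E \<Longrightarrow> w \<in> E \<Longrightarrow> norm (G z - G w) \<le> M * norm (z - w)"
  obtains g F D where "kirszbraun_g E G M = (\<lambda>p. ereal (g p))"
    and "\<And>p. conv_env (kirszbraun_g E G M) p = ereal (F p)"
    and "\<And>p. quad_tangent M F p (D p)"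
    and "\<And>z. z \<in> E \<Longrightarrow> D (z, 0) = (M *\<^sub>R z, G z)"
proof -
  obtain g where g: "kirszbraun_g E G M = (\<lambda>p. ereal (g p))"
    and g_le: "\<And>z p. z \<in> E \<Longrightarrow> g p \<le> paraboloid G M z p"
    and g_ge: "\<And>a p. (\<And>z. z \<in> E \<Longrightarrow> a \<le> paraboloid G M z p) \<Longrightarrow> a \<le> g p"
    using kirszbraun_g_real[of E M G] assms by blast
  have tg: "tangent_plane G M w p \<le> g p" if "w \<in> E" for w p
    by (intro g_ge tangent_plane_le_paraboloid M lip that)
  obtain w where w: "w \<in> E" using \<open>E \<noteq> {}\<close> by blast
  obtain F where F: "\<And>p. conv_env (\<lambda>p. ereal (g p)) p = ereal (F p)"
    and convex: "convex_on UNIV F" and cont: "continuous_on UNIV F" and Fg: "\<And>p. F p \<le> g p"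
    using conv_env_real[of "tangent_plane G M w" g "paraboloid G M w"] convex_on_tangent_plane
      continuous_on_tangent_plane tg[OF w] continuous_on_paraboloid g_le[OF w] by blast
  have "\<exists>A. quad_tangent M F p A" for p
  proof (rule quad_tangent_exists[OF convex])
    fix p q and s :: real assume s: "0 \<le> s" "s \<le> 1"
    show "(1 - s) * F p + s * F q - M * s * (1 - s) * (norm (p - q))\<^sup>2 \<le> F ((1 - s) *\<^sub>R p + s *\<^sub>R q)"
    proof (rule conv_env_semiconcave[OF F convex cont Fg _ s])
      fix p q
      show "(1 - s) * g p + s * g q - M * s * (1 - s) * (norm (p - q))\<^sup>2 \<le> g ((1 - s) *\<^sub>R p + s *\<^sub>R q)"
      proof (rule g_ge)
        fix z assume "z \<in> E"
        then have "(1 - s) * g p + s * g q - M * s * (1 - s) * (norm (p - q))\<^sup>2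
            \<le> (1 - s) * paraboloid G M z p + s * paraboloid G M z q - M * s * (1 - s) * (norm (p - q))\<^sup>2"
          using s by (intro diff_right_mono add_mono mult_left_mono g_le) auto
        also have "\<dots> = paraboloid G M z ((1 - s) *\<^sub>R p + s *\<^sub>R q)"
          by (rule paraboloid_affine_combination)
        finally show "(1 - s) * g p + s * g q - M * s * (1 - s) * (norm (p - q))\<^sup>2
            \<le> paraboloid G M z ((1 - s) *\<^sub>R p + s *\<^sub>R q)" .
      qed
    qed
  qed (use cont M in \<open>simp_all add: continuous_on_eq_continuous_at del: split_paired_All\<close>)
  then obtain D where D: "\<And>p. quad_tangent M F p (D p)" by metis
  moreover have "D (z, 0) = (M *\<^sub>R z, G z)" if z: "z \<in> E" for z
  proof (rule quad_tangent_le_eq[OF D])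
    fix q
    \<comment> \<open>At \<open>(z, 0)\<close> paraboloid and tangent plane have the same value, so
      the plane through \<open>F (z, 0)\<close> with this slope lies below
      \<open>tangent_plane G M z\<close>.\<close>
    have "F (z, 0) \<le> paraboloid G M z (z, 0)" using Fg g_le[OF z] by (rule order_trans)
    also have "\<dots> = M / 2 * (norm z)\<^sup>2" by (simp add: paraboloid_def power2_norm_eq_inner)
    finally have "F (z, 0) + inner (M *\<^sub>R z, G z) (q - (z, 0)) \<le> tangent_plane G M z q"
      by (simp add: tangent_plane_def)
    also have "ereal \<dots> \<le> conv_env (\<lambda>p. ereal (g p)) q"
      by (rule conv_env_greatest[OF convex_on_tangent_plane continuous_on_tangent_plane]) (simp add: tg z)
    finally show "F (z, 0) + inner (M *\<^sub>R z, G z) (q - (z, 0)) \<le> F q" by (simp add: F)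
  qed
  ultimately show thesis using that[OF g] F unfolding g by blast
qed

section \<open>The extension and its Lipschitz constant\<close>

theorem theorem2:
  fixes E :: "'x::{real_inner, complete_space} set"
    and G :: "'x \<Rightarrow> 'y::{real_inner, complete_space}"
  assumes "E \<noteq> {}"
    and "\<exists>C. lipschitz_on C E G"
  shows
    "(\<exists>G' :: 'x \<Rightarrow> 'y.
        (\<forall>x\<in>E. G' x = G x) \<and> (\<exists>C. lipschitz_on C UNIV G') \<and> Lip UNIV G' = Lip E G)
     \<and>
     (let M = Lip E G;
          g = kirszbraun_g E G M;
          F = (\<lambda>p. real_of_ereal (conv_env g p));
          G' = (\<lambda>x. gradient_Y F (x, 0))
      in (\<forall>p. \<bar>g p\<bar> \<noteq> \<infinity>) \<and>
         (\<forall>p. \<bar>conv_env g p\<bar> \<noteq> \<infinity>) \<and>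
         (\<forall>x. \<exists>D. GDERIV F (x, 0) :> D) \<and>
         (\<forall>x\<in>E. G' x = G x) \<and>
         (\<exists>C. lipschitz_on C UNIV G') \<and>
         Lip UNIV G' = M)"
proof -
  define M where "M = Lip E G"
  obtain C where C: "lipschitz_on C E G" using assms(2) ..
  have M: "0 \<le> M" unfolding M_def using C by (rule Lip_nonneg)
  have lip: "norm (G z - G w) \<le> M * norm (z - w)" if "z \<in> E" "w \<in> E" for z w
    unfolding M_def using C that by (rule norm_diff_le_Lip)
  obtain g F D where g: "kirszbraun_g E G M = (\<lambda>p. ereal (g p))"
    and F: "\<And>p. conv_env (kirszbraun_g E G M) p = ereal (F p)"
    and D: "\<And>p. quad_tangent M F p (D p)"
    and DE: "\<And>z. z \<in> E \<Longrightarrow> D (z, 0) = (M *\<^sub>R z, G z)"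
    using kirszbraun_conv_env[of E M G] assms(1) M lip by blast
  have F_eq: "(\<lambda>p. real_of_ereal (conv_env (kirszbraun_g E G M) p)) = F" by (simp add: F)
  define G' where "G' x = gradient_Y F (x, 0)" for x
  have G'_eq: "G' x = snd (D (x, 0))" for x
    unfolding G'_def gradient_Y_def by (simp add: gradient_eqI[OF quad_tangent_GDERIV[OF D]])
  have ext: "G' x = G x" if "x \<in> E" for x by (simp add: G'_eq DE that)
  have lip': "norm (G' x - G' y) \<le> M * norm (x - y)" for x y
  proof -
    \<comment> \<open>Subtracting \<open>M *\<^sub>R (x, 0)\<close> leaves the
      \<open>Y\<close>-component unchanged but improves the Lipschitz bound to
      \<open>M\<close>.\<close>
    let ?v = "(D (x, 0) - M *\<^sub>R (x, 0)) - (D (y, 0) - M *\<^sub>R (y, 0))"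
    have "norm (G' x - G' y) = norm (snd ?v)" by (simp add: G'_eq)
    also have "\<dots> \<le> norm ?v" by (metis norm_snd_le prod.collapse)
    also have "\<dots> \<le> M * norm ((x, 0) - (y, 0) :: 'x \<times> 'y)"
      by (rule quad_tangent_lipschitz[OF D D M])
    finally show ?thesis by simp
  qed
  have "lipschitz_on M UNIV G'"
    using lip' M by (intro lipschitz_onI) (auto simp: dist_norm)
  moreover have "Lip UNIV G' = M"
  proof (rule antisym)
    show "Lip UNIV G' \<le> M" using M lip' by (rule Lip_le)
    \<comment> \<open>On \<open>E\<close> the two maps agree, so the constant of the extension also
      serves for \<open>G\<close>.\<close>
    have "norm (G x - G y) \<le> Lip UNIV G' * norm (x - y)" if "x \<in> E" "y \<in> E" for x y
      using norm_diff_le_Lip[OF \<open>lipschitz_on M UNIV G'\<close>, of x y] ext that by simp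
    then show "M \<le> Lip UNIV G'"
      unfolding M_def using Lip_nonneg[OF \<open>lipschitz_on M UNIV G'\<close>] by (intro Lip_le)
  qed
  moreover have "\<exists>D. GDERIV F (x, 0) :> D" for x using quad_tangent_GDERIV[OF D] by blast
  ultimately show ?thesis
    unfolding Let_def M_def[symmetric] F_eq G'_def[symmetric] using ext F g by auto
qed

end
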